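(* For every $\nu\ge0$, $\alpha>-1$ and $n\in\mathbb{N}_0$, $$\frac{d}{dx}\left[p^\alpha_{n+1,n,n+1}(x)\right]=(3n+2)\,p^{\alpha+1}_{n+1,n,n}(x),$$ where $p^\alpha_{n+1,n,n+1}$ and $p^{\alpha+1}_{n+1,n,n}$ are the type 2 multiple orthogonal polynomials, defined in the context, for the vector of weights $(\rho_\nu^2,\rho_{\nu+1}^2,\rho_\nu\rho_{\nu+1})$ with additional factors $x^\alpha$ and $x^{\alpha+1}$, respectively.
   Context: For $x>0$, $\rho_\nu(x)=2x^{\nu/2}K_\nu(2\sqrt x)$, with $K_\nu$ the Macdonald function (modified Bessel function of the second kind). For $\alpha>-1$ and nonnegative integers $n_1,n_2,n_3$, the type 2 multiple orthogonal polynomial $p^\alpha_{n_1,n_2,n_3}$ is the monic polynomial of degree $n_1+n_2+n_3$ uniquely determined by the orthogonality conditions $$\int_0^\infty p^\alpha_{n_1,n_2,n_3}(x)\,\rho_\nu^2(x)\,x^{\alpha+m}\,dx=0,\qquad 0\le m\le n_1-1,$$ $$\int_0^\infty p^\alpha_{n_1,n_2,n_3}(x)\,\rho_{\nu+1}^2(x)\,x^{\alpha+m}\,dx=0,\qquad 0\le m\le n_2-1,$$ $$\int_0^\infty p^\alpha_{n_1,n_2,n_3}(x)\,\rho_\nu(x)\rho_{\nu+1}(x)\,x^{\alpha+m}\,dx=0,\qquad 0\le m\le n_3-1 .$$ Thus $p^\alpha_{n+1,n,n+1}$ has degree $3n+2$ and $p^{\alpha+1}_{n+1,n,n}$ has degree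 $3n+1$. As in the paper, these polynomials are regarded as uniquely determined (the number of linear conditions equals the number of unknown coefficients). *)

theory Defs
  imports "HOL-Analysis.Analysis" "HOL-Computational_Algebra.Polynomial"
begin

(* The Macdonald function (modified Bessel function of the second kind) of real order,
   given for z > 0 by its classical integral representation (DLMF 10.32.9). For z \<le> 0 the
   integral diverges and the value is meaningless. *)
definition Macdonald_K :: "real \<Rightarrow> real \<Rightarrow> real" where
  "Macdonald_K \<nu> z = (LBINT u:{0<..}. exp (- z * cosh u) * cosh (\<nu> * u))"

(* Meaningful for x > 0 only. *)
definition rho :: "real \<Rightarrow> real \<Rightarrow> real" where
  "rho \<nu> x = 2 * x powr (\<nu> / 2) * Macdonald_K \<nu> (2 * sqrt x)"

(* For \<nu> \<ge> 0 and \<alpha> > -1 all the integrands below are Lebesgue integrable: as x tends to 0 the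
   functions rho \<nu> and rho (\<nu> + 1) are bounded, except for a logarithm when \<nu> = 0, and both
   decay like exp (-2 * sqrt x), up to a power of x, at infinity. Hence no equation holds merely
   because the integral of a non-integrable function is 0 by convention. *)
definition is_type2_mop :: "real \<Rightarrow> real \<Rightarrow> nat \<Rightarrow> nat \<Rightarrow> nat \<Rightarrow> real poly \<Rightarrow> bool" where
  "is_type2_mop \<nu> \<alpha> n1 n2 n3 p \<longleftrightarrow>
     degree p = n1 + n2 + n3 \<and> lead_coeff p = 1 \<and>
     (\<forall>m<n1. (LBINT x:{0<..}. poly p x * (rho \<nu> x)\<^sup>2 * x powr (\<alpha> + real m)) = 0) \<and>
     (\<forall>m<n2. (LBINT x:{0<..}. poly p x * (rho (\<nu> + 1) x)\<^sup>2 * x powr (\<alpha> + real m)) = 0) \<and>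
     (\<forall>m<n3. (LBINT x:{0<..}. poly p x * (rho \<nu> x * rho (\<nu> + 1) x) * x powr (\<alpha> + real m)) = 0)"

(* Unspecified when the conditions do not determine exactly one polynomial. This does occur: for
   \<nu> = 1/2 one has rho (3/2) x = (1/2 + sqrt x) * rho (1/2) x, so the weights satisfy
   (rho (3/2) x)^2 - rho (1/2) x * rho (3/2) x + (1/4 - x) * (rho (1/2) x)^2 = 0. *)
definition type2_mop :: "real \<Rightarrow> real \<Rightarrow> nat \<Rightarrow> nat \<Rightarrow> nat \<Rightarrow> real poly" where
  "type2_mop \<nu> \<alpha> n1 n2 n3 = (THE p. is_type2_mop \<nu> \<alpha> n1 n2 n3 p)"

end

theory Submission
  imports Defs
begin

text \<open>
  With \<open>u = rho \<nu>\<close> and \<open>v = rho (\<nu> + 1)\<close>, the integral representation of the Macdonald function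
  gives \<open>x u' = \<nu> u - v\<close> and \<open>v' = - u\<close>. Hence \<open>x (u\<^sup>2)' = 2 \<nu> u\<^sup>2 - 2 u v\<close>,
  \<open>(v\<^sup>2)' = - 2 u v\<close> and \<open>x (u v)' = \<nu> u v - v\<^sup>2 - x u\<^sup>2\<close>, so integrating by parts turns each
  orthogonality integral of \<open>p'\<close> with exponent \<open>\<alpha> + 1\<close> into a combination of integrals of \<open>p\<close> with
  exponent \<open>\<alpha>\<close> that vanish. By uniqueness \<open>p' / (3 n + 2)\<close> is the polynomial on the right.
\<close>

section \<open>Elementary exponential bounds and integration over the half-line\<close>

text \<open>Raise y / s \<le> exp (y / s) to the power s. The free s lets exponential decay be
  traded for any power.\<close>

lemma exp_minus_le_powr:
  fixes s y :: real
  assumes "s > 0" "y > 0"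
  shows "exp (- y) \<le> s powr s * y powr (- s)"
proof -
  have "y / s \<le> exp (y / s)"
    using exp_ge_add_one_self[of "y / s"] by linarith
  then have "(y / s) powr s \<le> exp (y / s) powr s"
    using assms by (intro powr_mono2) auto
  also have "\<dots> = exp y"
    using assms by (simp add: powr_def)
  finally have "y powr s \<le> s powr s * exp y"
    using assms by (simp add: powr_divide field_simps)
  then show ?thesis
    using assms by (simp add: exp_minus powr_minus field_simps)
qed

text \<open>Since cosh u \<ge> exp u / 2, the previous bound applies with y = z * exp u / 2. It
  separates z from u: s fixes both the power of z and the rate of decay in u.\<close>

lemma exp_minus_cosh_le:
  fixes s z u :: real
  assumes "s > 0" "z > 0"
  shows "exp (- z * cosh u) \<le> (2 * s) powr s * z powr (- s) * exp (- s * u)"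
proof -
  have "exp u / 2 \<le> cosh u"
    by (simp add: cosh_def)
  then have "exp (- z * cosh u) \<le> exp (- (z * exp u / 2))"
    using assms by (simp add: mult_left_mono)
  also have "\<dots> \<le> s powr s * (z * exp u / 2) powr (- s)"
    by (rule exp_minus_le_powr) (use assms in auto)
  also have "\<dots> = (2 * s) powr s * z powr (- s) * exp (- s * u)"
    using assms by (simp add: powr_def ln_mult ln_div algebra_simps flip: exp_add)
  finally show ?thesis .
qed

text \<open>From (1 - y) * exp y \<le> 1 one gets 0 \<le> exp y - 1 - y \<le> y * (exp y - 1), and
  the last factor is at most \<bar>y\<bar> * exp \<bar>y\<bar> in absolute value. This remainder
  serves for differentiation under the integral sign.\<close>

lemma abs_exp_taylor1_le:
  fixes y :: real
  shows "\<bar>exp y - 1 - y\<bar> \<le> y\<^sup>2 * exp \<bar>y\<bar>"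
proof -
  have lower: "exp y - 1 - y \<ge> 0"
    using exp_ge_add_one_self[of y] by linarith
  have "(1 - y) * exp y \<le> exp (- y) * exp y"
    using exp_ge_add_one_self[of "- y"] by (intro mult_right_mono) auto
  then have "exp y - 1 \<le> y * exp y"
    by (simp add: algebra_simps flip: exp_add)
  then have 1: "exp y - 1 - y \<le> y * (exp y - 1)"
    by (simp add: algebra_simps)
  have 2: "\<bar>exp y - 1\<bar> \<le> \<bar>y\<bar> * exp \<bar>y\<bar>"
  proof (cases "y \<ge> 0")
    case True
    then show ?thesis using \<open>exp y - 1 \<le> y * exp y\<close> by simp
  next
    case False
    have "\<bar>exp y - 1\<bar> \<le> \<bar>y\<bar> * 1"
      using False exp_ge_add_one_self[of y] exp_le_one_iff[of y] by linarith
    also have "\<dots> \<le> \<bar>y\<bar> * exp \<bar>y\<bar>"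
      by (intro mult_left_mono) auto
    finally show ?thesis .
  qed
  have "y * (exp y - 1) \<le> \<bar>y\<bar> * \<bar>exp y - 1\<bar>"
    by (metis abs_ge_self abs_mult)
  also have "\<dots> \<le> \<bar>y\<bar> * (\<bar>y\<bar> * exp \<bar>y\<bar>)"
    using 2 by (intro mult_left_mono) auto
  finally show ?thesis
    using 1 lower by (simp add: power2_eq_square)
qed

text \<open>Passage from gauge integrals of explicit majorants to Lebesgue integrability: domination
  gives absolute integrability over \<open>lebesgue\<close>, and continuity supplies the Borel
  measurability needed to descend to \<open>lborel\<close>.\<close>

lemma set_integrable_lborel_bounded:
  fixes f g :: "real \<Rightarrow> real"
  assumes "S \<in> sets borel" "continuous_on S f" "g integrable_on S" "\<And>x. x \<in> S \<Longrightarrow> \<bar>f x\<bar> \<le> g x"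
  shows "set_integrable lborel S f"
proof -
  have meas: "(\<lambda>x. indicator S x *\<^sub>R f x) \<in> borel_measurable borel"
    using assms by (intro borel_measurable_continuous_on_indicator) auto
  have "f \<in> borel_measurable (lebesgue_on S)"
    using assms by (intro continuous_imp_measurable_on_sets_lebesgue) auto
  then have "set_integrable lebesgue S f"
    using assms by (intro measurable_bounded_by_integrable_imp_absolutely_integrable) auto
  then show ?thesis
    using meas by (simp add: set_integrable_def integrable_completion)
qed

lemma set_integral_Ioi_FTC:
  fixes F f :: "real \<Rightarrow> real"
  assumes "\<And>x. x > 0 \<Longrightarrow> (F has_real_derivative f x) (at x)"
    and "continuous_on {0<..} f" "set_integrable lborel {0<..} f"
    and "(F \<longlongrightarrow> a) (at_right 0)" "(F \<longlongrightarrow> b) at_top"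
  shows "(LBINT x:{0<..}. f x) = b - a"
proof -
  have eq: "einterval 0 \<infinity> = {0<..}"
    by (metis einterval_eq_Ici zero_ereal_def)
  have "(LBINT x=0..\<infinity>. f x) = b - a"
  proof (rule interval_integral_FTC_integrable[where F = F])
    show "((F \<circ> real_of_ereal) \<longlongrightarrow> a) (at_right 0)" "((F \<circ> real_of_ereal) \<longlongrightarrow> b) (at_left \<infinity>)"
      using assms(4,5) by (simp_all add: zero_ereal_def ereal_tendsto_simps1 del: zero_ereal_def[symmetric])
  qed (use assms(1-3) eq in \<open>auto simp: has_real_derivative_iff_has_vector_derivative continuous_on_eq_continuous_at\<close>)
  then show ?thesis
    by (simp add: interval_lebesgue_integral_def eq)
qed

section \<open>Integrals against the kernel exp (- z * cosh u)\<close>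

text \<open>The double exponential decay of the kernel beats any such growth, and the class is
  closed under multiplication by cosh, which is what each derivative in z produces.\<close>

definition exp_bounded :: "(real \<Rightarrow> real) \<Rightarrow> bool" where
  "exp_bounded g \<longleftrightarrow> continuous_on UNIV g \<and> (\<exists>C r. \<forall>u>0. \<bar>g u\<bar> \<le> C * exp (r * u))"

lemma exp_bounded_mult:
  assumes "exp_bounded f" "exp_bounded g"
  shows "exp_bounded (\<lambda>u. f u * g u)"
proof -
  obtain C r D s where C: "\<And>u. u > 0 \<Longrightarrow> \<bar>f u\<bar> \<le> C * exp (r * u)"
    and D: "\<And>u. u > 0 \<Longrightarrow> \<bar>g u\<bar> \<le> D * exp (s * u)"
    using assms unfolding exp_bounded_def by blast
  have "\<bar>f u * g u\<bar> \<le> C * D * exp ((r + s) * u)" if "u > 0" for u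
  proof -
    have "\<bar>f u * g u\<bar> \<le> (C * exp (r * u)) * (D * exp (s * u))"
      unfolding abs_mult using C[OF that] D[OF that] by (intro mult_mono) auto
    then show ?thesis
      by (simp add: algebra_simps exp_add)
  qed
  moreover have "continuous_on UNIV (\<lambda>u. f u * g u)"
    using assms unfolding exp_bounded_def by (intro continuous_intros) auto
  ultimately show ?thesis
    unfolding exp_bounded_def by blast
qed

lemma abs_cosh_le: "u > 0 \<Longrightarrow> \<bar>cosh (a * u :: real)\<bar> \<le> exp (\<bar>a\<bar> * u)"
  and abs_sinh_le: "u > 0 \<Longrightarrow> \<bar>sinh (a * u :: real)\<bar> \<le> exp (\<bar>a\<bar> * u)"
proof -
  assume "u > 0"
  then have *: "a * u \<le> \<bar>a\<bar> * u" "- (a * u) \<le> \<bar>a\<bar> * u"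
    by (auto simp: abs_if mult_le_cancel_right)
  define p q r where "p = exp (a * u)" and "q = exp (- (a * u))" and "r = exp (\<bar>a\<bar> * u)"
  have "0 < p" "p \<le> r" "0 < q" "q \<le> r"
    using * by (simp_all add: p_def q_def r_def)
  moreover have "cosh (a * u) = (p + q) / 2" "sinh (a * u) = (p - q) / 2"
    by (simp_all add: cosh_field_def sinh_field_def p_def q_def)
  ultimately show "\<bar>cosh (a * u)\<bar> \<le> exp (\<bar>a\<bar> * u)" "\<bar>sinh (a * u)\<bar> \<le> exp (\<bar>a\<bar> * u)"
    unfolding r_def[symmetric] by (auto simp: abs_le_iff)
qed

lemma exp_bounded_cosh: "exp_bounded (\<lambda>u. cosh (a * u))"
  and exp_bounded_sinh: "exp_bounded (\<lambda>u. sinh (a * u))"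
proof -
  have "\<forall>u>0. \<bar>cosh (a * u)\<bar> \<le> 1 * exp (\<bar>a\<bar> * u)" "\<forall>u>0. \<bar>sinh (a * u)\<bar> \<le> 1 * exp (\<bar>a\<bar> * u)"
    using abs_cosh_le abs_sinh_le by simp_all
  moreover have "continuous_on UNIV (\<lambda>u. cosh (a * u))" "continuous_on UNIV (\<lambda>u. sinh (a * u))"
    by (intro continuous_intros)+
  ultimately show "exp_bounded (\<lambda>u. cosh (a * u))" "exp_bounded (\<lambda>u. sinh (a * u))"
    unfolding exp_bounded_def by blast+
qed

lemma exp_bounded_cosh1: "exp_bounded cosh"
  using exp_bounded_cosh[of 1] by simp

lemma exp_bounded_abs: "exp_bounded g \<Longrightarrow> exp_bounded (\<lambda>u. \<bar>g u\<bar>)"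
  unfolding exp_bounded_def by (auto intro!: continuous_intros)

text \<open>A general factor g keeps derivatives in z, and the products arising from addition
  formulas, in the same form as the Macdonald integral.\<close>

definition cosh_kernel :: "(real \<Rightarrow> real) \<Rightarrow> real \<Rightarrow> real" where
  "cosh_kernel g z = (LBINT u:{0<..}. exp (- z * cosh u) * g u)"

lemma integrable_on_exp_minus_Ioi: "a > 0 \<Longrightarrow> (\<lambda>u::real. exp (- a * u)) integrable_on {0<..}"
proof -
  assume "a > 0"
  then have "(\<lambda>u. exp (- a * u)) integrable_on {0..}"
    by (rule integrable_on_exp_minus_to_infinity)
  then show ?thesis
    by (rule integrable_spike_set) (auto intro!: negligible_subset[OF negligible_sing[of 0]])
qed

lemma cosh_kernel_bounds:
  fixes g :: "real \<Rightarrow> real" and s z u :: real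
  assumes g: "\<And>u. u > 0 \<Longrightarrow> \<bar>g u\<bar> \<le> C * exp (r * u)" and "s > 0" "z > 0" "u > 0"
  shows "\<bar>exp (- z * cosh u) * g u\<bar> \<le> C * (2 * s) powr s * z powr (- s) * exp (- (s - r) * u)"
proof -
  have "\<bar>exp (- z * cosh u) * g u\<bar> \<le> ((2 * s) powr s * z powr (- s) * exp (- s * u)) * (C * exp (r * u))"
    unfolding abs_mult using exp_minus_cosh_le[OF assms(2,3), of u] g[OF assms(4)] by (intro mult_mono) auto
  also have "\<dots> = C * (2 * s) powr s * z powr (- s) * exp (- (s - r) * u)"
    by (simp add: algebra_simps flip: exp_add)
  finally show ?thesis .
qed

lemma set_integrable_cosh_kernel:
  assumes "exp_bounded g" "z > 0"
  shows "set_integrable lborel {0<..} (\<lambda>u. exp (- z * cosh u) * g u)"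
proof -
  obtain C r where C: "\<And>u. u > 0 \<Longrightarrow> \<bar>g u\<bar> \<le> C * exp (r * u)" and [continuous_intros]: "continuous_on {0<..} g"
    using assms unfolding exp_bounded_def by (meson continuous_on_subset subset_UNIV)
  show ?thesis
  proof (rule set_integrable_lborel_bounded)
    \<comment> \<open>The choice s = \<bar>r\<bar> + 1 is positive and exceeds r by at least 1, so
      the majorant decays.\<close>
    show "(\<lambda>u. C * (2 * (\<bar>r\<bar> + 1)) powr (\<bar>r\<bar> + 1) * z powr (- (\<bar>r\<bar> + 1)) * exp (- (\<bar>r\<bar> + 1 - r) * u)) integrable_on {0<..}"
      by (intro integrable_on_mult_right integrable_on_exp_minus_Ioi) auto
  qed (use assms cosh_kernel_bounds[OF C, of "\<bar>r\<bar> + 1" z] in \<open>auto intro!: continuous_intros\<close>)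
qed

text \<open>The pointwise bound has the factor z powr (- s) in front of exp (- (s - r) * u), which
  is integrable because s > r; the constant is therefore uniform in z.\<close>

lemma cosh_kernel_le_powr:
  fixes s :: real
  assumes "continuous_on UNIV g" "\<And>u. u > 0 \<Longrightarrow> \<bar>g u\<bar> \<le> C * exp (r * u)" "s > 0" "s > r"
  shows "\<exists>D. \<forall>z>0. \<bar>cosh_kernel g z\<bar> \<le> D * z powr (- s)"
proof -
  define I where "I = (LBINT u:{0<..}. exp (- (s - r) * u))"
  have int: "set_integrable lborel {0<..} (\<lambda>u. exp (- (s - r) * u))"
    using integrable_on_exp_minus_Ioi[of "s - r"] assms
    by (intro set_integrable_lborel_bounded[where g = "\<lambda>u. exp (- (s - r) * u)"] continuous_intros) auto
  have "\<bar>cosh_kernel g z\<bar> \<le> C * (2 * s) powr s * I * z powr (- s)" if "z > 0" for z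
  proof -
    have "exp_bounded g"
      unfolding exp_bounded_def using assms by blast
    note i = set_integrable_cosh_kernel[OF this that]
    have "\<bar>cosh_kernel g z\<bar> \<le> (LBINT u:{0<..}. \<bar>exp (- z * cosh u) * g u\<bar>)"
      using set_integral_norm_bound[OF i] by (simp add: cosh_kernel_def)
    also have "\<dots> \<le> (LBINT u:{0<..}. C * (2 * s) powr s * z powr (- s) * exp (- (s - r) * u))"
      using cosh_kernel_bounds[OF assms(2,3) that]
      by (intro set_integral_mono[OF set_integrable_abs[OF i] set_integrable_mult_right[OF int]]) auto
    finally show ?thesis
      by (simp add: I_def mult_ac)
  qed
  then show ?thesis by blast
qed

text \<open>Differentiation under the integral sign, done by hand: the first-order Taylor remainder
  of the kernel in h integrates to at most a constant times the square of h.\<close>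

lemma has_real_derivative_cosh_kernel:
  assumes g: "exp_bounded g" and z: "z > 0"
  shows "(cosh_kernel g has_real_derivative - cosh_kernel (\<lambda>u. cosh u * g u) z) (at z)"
proof -
  \<comment> \<open>The argument z / 2 leaves room for the factor exp (\<bar>h\<bar> * cosh u) in
    the remainder: for \<bar>h\<bar> \<le> z / 2 it uses up at most half of the decay of exp (- z *
    cosh u).\<close>
  define G where "G = cosh_kernel (\<lambda>u. cosh u * cosh u * \<bar>g u\<bar>) (z / 2)"
  note bdd = exp_bounded_mult[OF exp_bounded_cosh1 g]
    exp_bounded_mult[OF exp_bounded_mult[OF exp_bounded_cosh1 exp_bounded_cosh1] exp_bounded_abs[OF g]]
  have remainder: "\<bar>cosh_kernel g (z + h) - cosh_kernel g z + h * cosh_kernel (\<lambda>u. cosh u * g u) z\<bar> \<le> h\<^sup>2 * G"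
    if h: "\<bar>h\<bar> \<le> z / 2" for h
  proof -
    let ?R = "\<lambda>u. exp (- (z + h) * cosh u) * g u - exp (- z * cosh u) * g u
                    + h * (exp (- z * cosh u) * (cosh u * g u))"
    have zh: "z + h > 0" using h z by auto
    note i = set_integrable_cosh_kernel[OF g zh] set_integrable_cosh_kernel[OF g z]
      set_integrable_cosh_kernel[OF bdd(1) z]
    have j: "set_integrable lborel {0<..} ?R"
      by (intro set_integral_add set_integral_diff i set_integrable_mult_right)
    have k: "set_integrable lborel {0<..} (\<lambda>u. exp (- (z / 2) * cosh u) * (cosh u * cosh u * \<bar>g u\<bar>))"
      using set_integrable_cosh_kernel[OF bdd(2), of "z / 2"] z by simp
    have eq: "cosh_kernel g (z + h) - cosh_kernel g z + h * cosh_kernel (\<lambda>u. cosh u * g u) z = (LBINT u:{0<..}. ?R u)"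
      unfolding cosh_kernel_def using i
      by (simp add: set_integral_add set_integral_diff set_integrable_mult_right)
    have "\<bar>LBINT u:{0<..}. ?R u\<bar> \<le> (LBINT u:{0<..}. \<bar>?R u\<bar>)"
      using set_integral_norm_bound[OF j] by simp
    also have "\<dots> \<le> (LBINT u:{0<..}. h\<^sup>2 * (exp (- (z / 2) * cosh u) * (cosh u * cosh u * \<bar>g u\<bar>)))"
    proof (rule set_integral_mono[OF set_integrable_abs[OF j] set_integrable_mult_right[OF k]])
      fix u :: real
      \<comment> \<open>With this y the kernel at z + h is the kernel at z times exp y, so
        \<open>?R u\<close> contains exactly the remainder exp y - 1 - y.\<close>
      define y where "y = - h * cosh u"
      have **: "exp (- (z + h) * cosh u) = exp (- z * cosh u) * exp y" "h * (exp (- z * cosh u) * (cosh u * g u)) = - exp (- z * cosh u) * y * g u"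
        by (simp_all add: y_def algebra_simps flip: exp_add)
      have "?R u = exp (- z * cosh u) * (exp y - 1 - y) * g u"
        unfolding ** by (simp add: algebra_simps)
      then have "\<bar>?R u\<bar> = exp (- z * cosh u) * \<bar>exp y - 1 - y\<bar> * \<bar>g u\<bar>"
        by (simp add: abs_mult)
      also have "\<dots> \<le> exp (- z * cosh u) * (y\<^sup>2 * exp \<bar>y\<bar>) * \<bar>g u\<bar>"
        by (intro mult_right_mono mult_left_mono abs_exp_taylor1_le) auto
      also have "\<dots> = exp (- z * cosh u + \<bar>y\<bar>) * (y\<^sup>2 * \<bar>g u\<bar>)"
        unfolding exp_add by (simp add: mult_ac)
      also have "\<dots> \<le> exp (- (z / 2) * cosh u) * (y\<^sup>2 * \<bar>g u\<bar>)"
      proof -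
        have "\<bar>y\<bar> \<le> z / 2 * cosh u"
          using h mult_right_mono[OF h, of "cosh u"] by (simp add: y_def abs_mult)
        then show ?thesis
          by (intro mult_right_mono) auto
      qed
      finally show "\<bar>?R u\<bar> \<le> h\<^sup>2 * (exp (- (z / 2) * cosh u) * (cosh u * cosh u * \<bar>g u\<bar>))"
        by (simp add: y_def power2_eq_square mult_ac)
    qed
    finally show ?thesis
      unfolding eq by (simp add: G_def cosh_kernel_def)
  qed
  have "((\<lambda>h. (cosh_kernel g (z + h) - cosh_kernel g z) / h + cosh_kernel (\<lambda>u. cosh u * g u) z) \<longlongrightarrow> 0) (at 0)"
  proof (rule Lim_null_comparison)
    have "\<forall>\<^sub>F h in at 0. \<bar>h\<bar> < z / 2 \<and> h \<noteq> 0"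
      using z by (auto simp: eventually_at dist_real_def intro!: exI[of _ "z / 2"])
    then show "\<forall>\<^sub>F h in at 0. norm ((cosh_kernel g (z + h) - cosh_kernel g z) / h + cosh_kernel (\<lambda>u. cosh u * g u) z) \<le> \<bar>h\<bar> * G"
    proof eventually_elim
      case (elim h)
      have "\<bar>(cosh_kernel g (z + h) - cosh_kernel g z) / h + cosh_kernel (\<lambda>u. cosh u * g u) z\<bar>
        = \<bar>cosh_kernel g (z + h) - cosh_kernel g z + h * cosh_kernel (\<lambda>u. cosh u * g u) z\<bar> / \<bar>h\<bar>"
        using elim by (simp add: field_simps flip: abs_divide)
      also have "\<dots> \<le> h\<^sup>2 * G / \<bar>h\<bar>"
        using remainder[of h] elim by (intro divide_right_mono) auto
      also have "\<dots> = \<bar>h\<bar> * G"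
        using elim by (simp add: power2_eq_square field_simps abs_if)
      finally show ?case by simp
    qed
    show "((\<lambda>h. \<bar>h\<bar> * G) \<longlongrightarrow> 0) (at 0)"
      by (auto intro!: tendsto_eq_intros)
  qed
  then show ?thesis
    using LIM_offset_zero_cancel
    by (auto simp: DERIV_def LIM_zero_iff[where l = "- _", symmetric])
qed

section \<open>Derivative of the Macdonald function\<close>

lemma Macdonald_K_eq_cosh_kernel: "Macdonald_K \<nu> = cosh_kernel (\<lambda>u. cosh (\<nu> * u))"
  by (simp add: Macdonald_K_def cosh_kernel_def fun_eq_iff)

lemma Macdonald_K_minus: "Macdonald_K (- \<nu>) = Macdonald_K \<nu>"
  by (simp add: Macdonald_K_def fun_eq_iff)

lemma cosh_kernel_add:
  assumes "exp_bounded f" "exp_bounded g" "z > 0"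
  shows "cosh_kernel (\<lambda>u. f u + g u) z = cosh_kernel f z + cosh_kernel g z"
  using set_integral_add(2)[OF assms(1,2)[THEN set_integrable_cosh_kernel[OF _ assms(3)]]]
  by (simp add: cosh_kernel_def distrib_left)

text \<open>Integrate the derivative of exp (- z * cosh u) * sinh (\<mu> * u): the boundary terms
  vanish by sinh 0 = 0 and by decay at infinity. By the product formula for sinh this is the
  three-term recurrence linking the orders \<mu> - 1, \<mu> and \<mu> + 1.\<close>

lemma cosh_kernel_sinh_sinh:
  assumes z: "z > 0"
  shows "z * cosh_kernel (\<lambda>u. sinh u * sinh (\<mu> * u)) z = \<mu> * Macdonald_K \<mu> z"
proof -
  define F where "F = (\<lambda>u. exp (- z * cosh u) * sinh (\<mu> * u))"
  define f where "f = (\<lambda>u. \<mu> * (exp (- z * cosh u) * cosh (\<mu> * u)) - z * (exp (- z * cosh u) * (sinh u * sinh (\<mu> * u))))"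
  have "exp_bounded (\<lambda>u. sinh u * sinh (\<mu> * u))"
    using exp_bounded_mult[OF exp_bounded_sinh[of 1] exp_bounded_sinh[of \<mu>]] by simp
  note i = set_integrable_cosh_kernel[OF exp_bounded_cosh[of \<mu>] z] set_integrable_cosh_kernel[OF this z]
  have "(LBINT u:{0<..}. f u) = 0 - 0"
  proof (rule set_integral_Ioi_FTC)
    show "(F has_real_derivative f u) (at u)" for u
      unfolding F_def f_def by (auto intro!: derivative_eq_intros simp: algebra_simps)
    show "continuous_on {0<..} f"
      unfolding f_def by (intro continuous_intros)
    show "set_integrable lborel {0<..} f"
      unfolding f_def by (intro set_integral_diff set_integrable_mult_right i)
    have "isCont F 0"
      unfolding F_def by (intro continuous_intros)
    then show "(F \<longlongrightarrow> 0) (at_right 0)"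
      by (simp add: F_def isCont_def filterlim_at_split)
    \<comment> \<open>This is the constant of \<open>cosh_kernel_bounds\<close> for C = 1, r =
      \<bar>\<mu>\<bar> and s = r + 1, which leaves exactly the decay exp (- u).\<close>
    define D where "D = 1 * (2 * (\<bar>\<mu>\<bar> + 1)) powr (\<bar>\<mu>\<bar> + 1) * z powr (- (\<bar>\<mu>\<bar> + 1))"
    show "(F \<longlongrightarrow> 0) at_top"
    proof (rule Lim_null_comparison)
      show "\<forall>\<^sub>F u in at_top. norm (F u) \<le> D * exp (- u)"
        using eventually_gt_at_top[of 0]
      proof eventually_elim
        case (elim u)
        have "\<bar>sinh (\<mu> * u)\<bar> \<le> 1 * exp (\<bar>\<mu>\<bar> * u)" if "u > 0" for u
          using abs_sinh_le[OF that] by simp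
        from cosh_kernel_bounds[OF this, of "\<bar>\<mu>\<bar> + 1" z u] show ?case
          using z elim by (simp add: F_def D_def)
      qed
      have "((\<lambda>u::real. exp (- u)) \<longlongrightarrow> 0) at_top"
        by (rule filterlim_compose[OF exp_at_bot filterlim_uminus_at_bot_at_top])
      then show "((\<lambda>u. D * exp (- u)) \<longlongrightarrow> 0) at_top"
        by (rule tendsto_mult_right_zero)
    qed
  qed
  moreover have "(LBINT u:{0<..}. f u) = \<mu> * Macdonald_K \<mu> z - z * cosh_kernel (\<lambda>u. sinh u * sinh (\<mu> * u)) z"
    unfolding f_def Macdonald_K_eq_cosh_kernel cosh_kernel_def
    by (subst set_integral_diff(2)) (simp_all only: set_integrable_mult_right i set_integral_mult_right)
  ultimately show ?thesis by simp
qed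

text \<open>The addition formula splits the integral of order \<mu> + 1 into a cosh-cosh part, which
  is minus the derivative at order \<mu>, and a sinh-sinh part, known from the previous
  lemma.\<close>

lemma has_real_derivative_Macdonald_K:
  assumes z: "z > 0"
  shows "(Macdonald_K \<mu> has_real_derivative \<mu> / z * Macdonald_K \<mu> z - Macdonald_K (\<mu> + 1) z) (at z)"
proof -
  have "exp_bounded (\<lambda>u. cosh u * cosh (\<mu> * u))" "exp_bounded (\<lambda>u. sinh u * sinh (\<mu> * u))"
    using exp_bounded_mult[OF exp_bounded_cosh[of 1] exp_bounded_cosh[of \<mu>]]
      exp_bounded_mult[OF exp_bounded_sinh[of 1] exp_bounded_sinh[of \<mu>]] by simp_all
  note cosh_kernel_add[OF this z]
  moreover have "cosh ((\<mu> + 1) * u) = cosh u * cosh (\<mu> * u) + sinh u * sinh (\<mu> * u)" for u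
    by (simp add: distrib_right add.commute[of _ u] cosh_add)
  ultimately have "Macdonald_K (\<mu> + 1) z
      = cosh_kernel (\<lambda>u. cosh u * cosh (\<mu> * u)) z + cosh_kernel (\<lambda>u. sinh u * sinh (\<mu> * u)) z"
    by (simp add: Macdonald_K_eq_cosh_kernel)
  then have "- cosh_kernel (\<lambda>u. cosh u * cosh (\<mu> * u)) z = \<mu> / z * Macdonald_K \<mu> z - Macdonald_K (\<mu> + 1) z"
    using cosh_kernel_sinh_sinh[OF z, of \<mu>] z by (simp add: field_simps)
  then show ?thesis
    using has_real_derivative_cosh_kernel[OF exp_bounded_cosh[of \<mu>] z]
    by (simp add: Macdonald_K_eq_cosh_kernel)
qed

section \<open>First-order differential relations for \<open>rho\<close>\<close>

lemma has_real_derivative_rho: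
  assumes x: "x > 0"
  shows "(rho \<mu> has_real_derivative (\<mu> * rho \<mu> x - rho (\<mu> + 1) x) / x) (at x)"
proof -
  have 1: "((\<lambda>x. Macdonald_K \<mu> (2 * sqrt x)) has_real_derivative
      (\<mu> / (2 * sqrt x) * Macdonald_K \<mu> (2 * sqrt x) - Macdonald_K (\<mu> + 1) (2 * sqrt x)) * (1 / sqrt x)) (at x)"
    by (rule DERIV_chain2[OF has_real_derivative_Macdonald_K])
       (use x in \<open>auto intro!: derivative_eq_intros simp: field_simps\<close>)
  have "(rho \<mu> has_real_derivative
      2 * (x powr (\<mu> / 2) * (\<mu> / 2 / x)) * Macdonald_K \<mu> (2 * sqrt x)
      + 2 * x powr (\<mu> / 2) * ((\<mu> / (2 * sqrt x) * Macdonald_K \<mu> (2 * sqrt x) - Macdonald_K (\<mu> + 1) (2 * sqrt x)) * (1 / sqrt x))) (at x)"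
    unfolding rho_def[abs_def]
    by (rule DERIV_cong[OF DERIV_mult[OF _ 1]])
       (use x in \<open>auto intro!: derivative_eq_intros simp: powr_diff mult_ac\<close>)
  moreover have "x powr ((\<mu> + 1) / 2) = x powr (\<mu> / 2) * sqrt x"
    using x by (simp add: add_divide_distrib powr_add powr_half_sqrt)
  \<comment> \<open>Writing r for sqrt x makes this an identity of rational functions, with x = r *
    r.\<close>
  moreover have "2 * (P * (\<mu> / 2 / (r * r))) * K + 2 * P * ((\<mu> / (2 * r) * K - L) * (1 / r))
      = (\<mu> * (2 * P * K) - 2 * (P * r) * L) / (r * r)" if "r > 0" for P K L r :: real
    using that by (simp add: field_simps)
  from this[of "sqrt x"] have "2 * (P * (\<mu> / 2 / x)) * K + 2 * P * ((\<mu> / (2 * sqrt x) * K - L) * (1 / sqrt x))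
      = (\<mu> * (2 * P * K) - 2 * (P * sqrt x) * L) / x" for P K L
    using x by simp
  ultimately show ?thesis
    by (simp only: rho_def)
qed

text \<open>The Macdonald function is even in its order, so only the power in front changes. This
  reflection converts the relation that raises the order into one that lowers it.\<close>

lemma rho_minus: "x > 0 \<Longrightarrow> rho \<mu> x = x powr \<mu> * rho (- \<mu>) x"
  by (simp add: rho_def Macdonald_K_minus mult_ac flip: powr_add)

text \<open>Reflect to order - (\<mu> + 1) and differentiate there: the terms of that order cancel,
  and the remaining term of order - \<mu> reflects back to \<open>rho \<mu>\<close>.\<close>

lemma has_real_derivative_rho_Suc:
  assumes x: "x > 0"
  shows "(rho (\<mu> + 1) has_real_derivative - rho \<mu> x) (at x)"
proof -
  have "((\<lambda>x. x powr (\<mu> + 1) * rho (- (\<mu> + 1)) x) has_real_derivative - rho \<mu> x) (at x)"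
    by (rule DERIV_cong[OF DERIV_mult[OF has_real_derivative_powr[OF x] has_real_derivative_rho[OF x]]])
       (use x in \<open>simp add: rho_minus[OF x, of \<mu>] powr_add field_simps\<close>)
  then show ?thesis
    by (rule has_field_derivative_transform_within_open[of _ _ _ "{0<..}"])
       (use x rho_minus[of _ "\<mu> + 1"] in auto)
qed

section \<open>Functions controlled by negative powers, their integrability and boundary
  values\<close>

text \<open>One bound for every \<open>t > 0\<close>: small \<open>t\<close> controls \<open>f\<close> near 0, large \<open>t\<close> near infinity.\<close>
definition moderate :: "(real \<Rightarrow> real) \<Rightarrow> bool" where
  "moderate f \<longleftrightarrow> continuous_on {0<..} f \<and> (\<forall>t>0. \<exists>C. \<forall>x>0. \<bar>f x\<bar> \<le> C * x powr (- t))"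

lemma moderate_rho:
  assumes "\<mu> \<ge> 0"
  shows "moderate (rho \<mu>)"
  unfolding moderate_def
proof (intro conjI allI impI)
  show "continuous_on {0<..} (rho \<mu>)"
    by (rule DERIV_continuous_on, rule has_field_derivative_at_within, rule has_real_derivative_rho, simp)
  fix t :: real
  assume t: "t > 0"
  have "\<bar>cosh (\<mu> * u)\<bar> \<le> 1 * exp (\<mu> * u)" if "u > 0" for u
    using abs_cosh_le[OF that, of \<mu>] assms by simp
  \<comment> \<open>At z = 2 * sqrt x the exponent \<mu> + 2 * t becomes \<mu> / 2 + t in x; the
    first part cancels the prefactor of \<open>rho\<close> and leaves x powr (- t). It exceeds the
    growth rate \<mu> because t > 0.\<close>
  then have "\<exists>D. \<forall>z>0. \<bar>Macdonald_K \<mu> z\<bar> \<le> D * z powr (- (\<mu> + 2 * t))"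
    unfolding Macdonald_K_eq_cosh_kernel using assms t
    by (intro cosh_kernel_le_powr[where C = 1 and r = \<mu>] continuous_intros) auto
  then obtain D where D: "\<And>z. z > 0 \<Longrightarrow> \<bar>Macdonald_K \<mu> z\<bar> \<le> D * z powr (- (\<mu> + 2 * t))"
    by blast
  have "\<bar>rho \<mu> x\<bar> \<le> 2 * D * 2 powr (- (\<mu> + 2 * t)) * x powr (- t)" if "x > 0" for x
  proof -
    have "\<bar>rho \<mu> x\<bar> \<le> 2 * x powr (\<mu> / 2) * (D * (2 * sqrt x) powr (- (\<mu> + 2 * t)))"
      unfolding rho_def abs_mult using D[of "2 * sqrt x"] that by (intro mult_mono) auto
    also have "(2 * sqrt x) powr (- (\<mu> + 2 * t)) = 2 powr (- (\<mu> + 2 * t)) * (x powr (- (\<mu> / 2)) * x powr (- t))"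
      using that by (simp add: powr_mult powr_powr diff_divide_distrib flip: powr_half_sqrt powr_add)
    finally show ?thesis
      using that by (simp add: powr_minus field_simps)
  qed
  then show "\<exists>C. \<forall>x>0. \<bar>rho \<mu> x\<bar> \<le> C * x powr (- t)" by blast
qed

lemma moderate_mult:
  assumes "moderate f" "moderate g"
  shows "moderate (\<lambda>x. f x * g x)"
  unfolding moderate_def
proof (intro conjI allI impI)
  show "continuous_on {0<..} (\<lambda>x. f x * g x)"
    using assms unfolding moderate_def by (intro continuous_intros) auto
  fix t :: real
  assume "t > 0"
  then obtain C D where C: "\<And>x. x > 0 \<Longrightarrow> \<bar>f x\<bar> \<le> C * x powr (- (t / 2))"
    and D: "\<And>x. x > 0 \<Longrightarrow> \<bar>g x\<bar> \<le> D * x powr (- (t / 2))"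
    using assms unfolding moderate_def by (meson half_gt_zero)
  have "\<bar>f x * g x\<bar> \<le> C * D * x powr (- t)" if "x > 0" for x
  proof -
    have "\<bar>f x * g x\<bar> \<le> (C * x powr (- (t / 2))) * (D * x powr (- (t / 2)))"
      unfolding abs_mult using C[OF that] D[OF that] by (intro mult_mono) auto
    then show ?thesis
      by (simp add: mult_ac flip: powr_add)
  qed
  then show "\<exists>C. \<forall>x>0. \<bar>f x * g x\<bar> \<le> C * x powr (- t)" by blast
qed

lemma moderate_add:
  assumes "moderate f" "moderate g"
  shows "moderate (\<lambda>x. f x + g x)"
  unfolding moderate_def
proof (intro conjI allI impI)
  show "continuous_on {0<..} (\<lambda>x. f x + g x)"
    using assms unfolding moderate_def by (intro continuous_intros) auto
  fix t :: real
  assume "t > 0"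
  then obtain C D where C: "\<And>x. x > 0 \<Longrightarrow> \<bar>f x\<bar> \<le> C * x powr (- t)"
    and D: "\<And>x. x > 0 \<Longrightarrow> \<bar>g x\<bar> \<le> D * x powr (- t)"
    using assms unfolding moderate_def by meson
  have "\<bar>f x + g x\<bar> \<le> (C + D) * x powr (- t)" if "x > 0" for x
    using C[OF that] D[OF that] by (simp add: distrib_right)
  then show "\<exists>C. \<forall>x>0. \<bar>f x + g x\<bar> \<le> C * x powr (- t)" by blast
qed

lemma moderate_cmult:
  assumes "moderate f"
  shows "moderate (\<lambda>x. c * f x)"
  unfolding moderate_def
proof (intro conjI allI impI)
  show "continuous_on {0<..} (\<lambda>x. c * f x)"
    using assms unfolding moderate_def by (intro continuous_intros) auto
  fix t :: real
  assume "t > 0"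
  then obtain C where C: "\<And>x. x > 0 \<Longrightarrow> \<bar>f x\<bar> \<le> C * x powr (- t)"
    using assms unfolding moderate_def by meson
  have "\<bar>c * f x\<bar> \<le> \<bar>c\<bar> * C * x powr (- t)" if "x > 0" for x
    using mult_left_mono[OF C[OF that], of "\<bar>c\<bar>"] by (simp add: abs_mult mult_ac)
  then show "\<exists>C. \<forall>x>0. \<bar>c * f x\<bar> \<le> C * x powr (- t)" by blast
qed

text \<open>The extra factor x is absorbed by taking the bound at t + 1. Hence the class admits
  polynomial factors despite their growth.\<close>

lemma moderate_times_id:
  assumes "moderate f"
  shows "moderate (\<lambda>x. x * f x)"
  unfolding moderate_def
proof (intro conjI allI impI)
  show "continuous_on {0<..} (\<lambda>x. x * f x)"
    using assms unfolding moderate_def by (intro continuous_intros) auto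
  fix t :: real
  assume "t > 0"
  then obtain C where C: "\<And>x. x > 0 \<Longrightarrow> \<bar>f x\<bar> \<le> C * x powr (- (t + 1))"
    using assms unfolding moderate_def by (meson add_pos_pos zero_less_one)
  have "\<bar>x * f x\<bar> \<le> C * x powr (- t)" if "x > 0" for x
  proof -
    have "\<bar>x * f x\<bar> \<le> x * (C * x powr (- (t + 1)))"
      using mult_left_mono[OF C[OF that], of x] that by (simp add: abs_mult)
    also have "\<dots> = C * x powr (- t)"
      using that by (simp add: powr_diff field_simps powr_minus powr_add)
    finally show ?thesis .
  qed
  then show "\<exists>C. \<forall>x>0. \<bar>x * f x\<bar> \<le> C * x powr (- t)" by blast
qed

lemma moderate_poly_mult:
  assumes "moderate f"
  shows "moderate (\<lambda>x. poly p x * f x)"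
proof (induction p)
  case 0
  then show ?case using moderate_cmult[OF assms, of 0] by simp
next
  case (pCons a p)
  then show ?case
    using moderate_add[OF moderate_cmult[OF assms, of a] moderate_times_id[OF pCons.IH]]
    by (simp add: algebra_simps)
qed

text \<open>Split at 1 and choose t separately on each side: t = (s + 1) / 2 leaves the exponent (s
  - 1) / 2 > -1 near 0, and t = s + 2 leaves -2 near infinity.\<close>

lemma set_integrable_moderate_powr:
  assumes "moderate f" "s > -1"
  shows "set_integrable lborel {0<..} (\<lambda>x. f x * x powr s)"
proof -
  have cont: "continuous_on S (\<lambda>x. f x * x powr s)" if "S \<subseteq> {0<..}" for S
    using assms that unfolding moderate_def by (intro continuous_intros) (auto intro: continuous_on_subset)
  have bound: "\<exists>C. \<forall>x>0. \<bar>f x * x powr s\<bar> \<le> C * x powr (s - t)" if "t > 0" for t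
  proof -
    obtain C where C: "\<And>x. x > 0 \<Longrightarrow> \<bar>f x\<bar> \<le> C * x powr (- t)"
      using assms \<open>t > 0\<close> unfolding moderate_def by meson
    have "\<bar>f x * x powr s\<bar> \<le> C * x powr (s - t)" if "x > 0" for x
      using mult_right_mono[OF C[OF that], of "x powr s"]
      by (simp add: abs_mult mult.assoc flip: powr_add)
    then show ?thesis by blast
  qed
  obtain C where C: "\<And>x. x > 0 \<Longrightarrow> \<bar>f x * x powr s\<bar> \<le> C * x powr (s - (s + 1) / 2)"
    using bound[of "(s + 1) / 2"] assms by auto
  have "set_integrable lborel {0<..1} (\<lambda>x. f x * x powr s)"
  proof (rule set_integrable_lborel_bounded)
    show "(\<lambda>x. C * x powr (s - (s + 1) / 2)) integrable_on {0<..1}"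
      using assms by (intro integrable_on_mult_right integrable_on_powr_from_0') (auto simp: field_simps)
  qed (use C in \<open>auto intro!: cont\<close>)
  moreover obtain D where D: "\<And>x. x > 0 \<Longrightarrow> \<bar>f x * x powr s\<bar> \<le> D * x powr (s - (s + 2))"
    using bound[of "s + 2"] assms by auto
  have "set_integrable lborel {1..} (\<lambda>x. f x * x powr s)"
  proof (rule set_integrable_lborel_bounded)
    have "(\<lambda>x::real. x powr (s - (s + 2))) integrable_on {1..}"
      using has_integral_powr_to_inf[of "s - (s + 2)" 1] unfolding integrable_on_def by auto
    then show "(\<lambda>x. D * x powr (s - (s + 2))) integrable_on {1..}"
      by (rule integrable_on_mult_right)
  qed (use D in \<open>auto intro!: cont\<close>)
  ultimately have "set_integrable lborel ({0<..1} \<union> {1..}) (\<lambda>x. f x * x powr s)"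
    by (intro set_integrable_Un) auto
  moreover have "{0<..1} \<union> {1..} = {0::real<..}" by auto
  ultimately show ?thesis by simp
qed

text \<open>Again two choices of t: s / 2 leaves a positive exponent at 0, and 2 * s leaves a
  negative one at infinity.\<close>

lemma moderate_powr_tendsto_0:
  assumes "moderate f" "s > 0"
  shows "((\<lambda>x. f x * x powr s) \<longlongrightarrow> 0) (at_right 0)" "((\<lambda>x. f x * x powr s) \<longlongrightarrow> 0) at_top"
proof -
  have bound: "\<exists>C. \<forall>x>0. norm (f x * x powr s) \<le> C * x powr (s - t)" if "t > 0" for t
  proof -
    obtain C where C: "\<And>x. x > 0 \<Longrightarrow> \<bar>f x\<bar> \<le> C * x powr (- t)"
      using assms \<open>t > 0\<close> unfolding moderate_def by meson
    have "norm (f x * x powr s) \<le> C * x powr (s - t)" if "x > 0" for x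
      using mult_right_mono[OF C[OF that], of "x powr s"]
      by (simp add: abs_mult mult.assoc flip: powr_add)
    then show ?thesis by blast
  qed
  obtain C where C: "\<forall>x>0. norm (f x * x powr s) \<le> C * x powr (s - s / 2)"
    using bound[of "s / 2"] assms by auto
  show "((\<lambda>x. f x * x powr s) \<longlongrightarrow> 0) (at_right 0)"
  proof (rule Lim_null_comparison)
    show "\<forall>\<^sub>F x in at_right 0. norm (f x * x powr s) \<le> C * x powr (s - s / 2)"
      using eventually_at_right_less[of 0] by eventually_elim (use C in auto)
    have "((\<lambda>x::real. x powr (s / 2)) \<longlongrightarrow> 0 powr (s / 2)) (at_right 0)"
      using assms by (intro tendsto_powr') (auto simp: eventually_at_filter)
    then show "((\<lambda>x. C * x powr (s - s / 2)) \<longlongrightarrow> 0) (at_right 0)"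
      by (intro tendsto_mult_right_zero) simp
  qed
  obtain D where D: "\<forall>x>0. norm (f x * x powr s) \<le> D * x powr (s - 2 * s)"
    using bound[of "2 * s"] assms by auto
  show "((\<lambda>x. f x * x powr s) \<longlongrightarrow> 0) at_top"
  proof (rule Lim_null_comparison)
    show "\<forall>\<^sub>F x in at_top. norm (f x * x powr s) \<le> D * x powr (s - 2 * s)"
      using eventually_gt_at_top[of 0] by eventually_elim (use D in auto)
    show "((\<lambda>x. D * x powr (s - 2 * s)) \<longlongrightarrow> 0) at_top"
      using assms by (intro tendsto_mult_right_zero tendsto_neg_powr) (auto simp: filterlim_ident)
  qed
qed

text \<open>The integrand is the derivative of f x * x powr (s + 1), whose limits at both ends are 0
  since s + 1 > 0. The function g stands for x * f' because the weights have derivatives that are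
  naturally expressed after multiplication by x.\<close>

lemma moderate_integral_by_parts:
  assumes "moderate f" "moderate g" "s > -1"
    and "\<And>x. x > 0 \<Longrightarrow> (f has_real_derivative g x / x) (at x)"
  shows "(LBINT x:{0<..}. (g x + (s + 1) * f x) * x powr s) = 0"
proof -
  have "moderate (\<lambda>x. g x + (s + 1) * f x)"
    by (intro moderate_add moderate_cmult assms)
  then have "(LBINT x:{0<..}. (g x + (s + 1) * f x) * x powr s) = 0 - 0"
  proof (intro set_integral_Ioi_FTC[where F = "\<lambda>x. f x * x powr (s + 1)"])
    fix x :: real
    assume "x > 0"
    then show "((\<lambda>x. f x * x powr (s + 1)) has_real_derivative (g x + (s + 1) * f x) * x powr s) (at x)"
      by (intro DERIV_cong[OF DERIV_mult[OF assms(4) has_real_derivative_powr]])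
         (auto simp: powr_add field_simps)
  qed (use assms in \<open>auto intro!: set_integrable_moderate_powr moderate_powr_tendsto_0 continuous_intros simp: moderate_def\<close>)
  then show ?thesis by simp
qed

section \<open>Integration by parts for the orthogonality integrals\<close>

definition weighted_integral :: "real poly \<Rightarrow> (real \<Rightarrow> real) \<Rightarrow> real \<Rightarrow> real" where
  "weighted_integral p w s = (LBINT x:{0<..}. poly p x * w x * x powr s)"

lemma weighted_integral_smult: "weighted_integral (smult c p) w s = c * weighted_integral p w s"
  by (simp add: weighted_integral_def mult.assoc)

lemma weighted_integral_cmult: "weighted_integral p (\<lambda>x. c * w x) s = c * weighted_integral p w s"
  by (simp add: weighted_integral_def mult_ac)

lemma weighted_integral_add:
  assumes "moderate v" "moderate w" "s > -1"
  shows "weighted_integral p (\<lambda>x. v x + w x) s = weighted_integral p v s + weighted_integral p w s"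
  unfolding weighted_integral_def distrib_left distrib_right
  by (intro set_integral_add(2) set_integrable_moderate_powr moderate_poly_mult assms)

lemma weighted_integral_times_id: "weighted_integral p (\<lambda>x. x * w x) s = weighted_integral p w (s + 1)"
  unfolding weighted_integral_def
  by (intro set_lebesgue_integral_cong) (auto simp: powr_add)

text \<open>Apply the vanishing integral to f = p * w, for which x * f' = x * p' * w + p * v. The
  factor x before p' accounts for the exponent s + 1 on the left.\<close>

lemma weighted_integral_pderiv:
  assumes "moderate w" "moderate v" "s > -1"
    and deriv: "\<And>x. x > 0 \<Longrightarrow> (w has_real_derivative v x / x) (at x)"
  shows "weighted_integral (pderiv p) w (s + 1) = - (s + 1) * weighted_integral p w s - weighted_integral p v s"
proof -
  note mod = moderate_poly_mult[OF assms(1), of p] moderate_poly_mult[OF assms(2), of p]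
    moderate_times_id[OF moderate_poly_mult[OF assms(1), of "pderiv p"]]
  note i = mod[THEN set_integrable_moderate_powr[OF _ assms(3)]]
  have "((\<lambda>x. poly p x * w x) has_real_derivative
      (x * (poly (pderiv p) x * w x) + poly p x * v x) / x) (at x)" if "x > 0" for x
    by (rule DERIV_cong[OF DERIV_mult[OF poly_DERIV deriv[OF that]]]) (use that in \<open>simp add: field_simps\<close>)
  from moderate_integral_by_parts[OF mod(1) moderate_add[OF mod(3,2)] assms(3) this]
  have "0 = (LBINT x:{0<..}. ((x * (poly (pderiv p) x * w x) + poly p x * v x)
                              + (s + 1) * (poly p x * w x)) * x powr s)"
    by simp
  also have "\<dots> = (LBINT x:{0<..}. x * (poly (pderiv p) x * w x) * x powr s + poly p x * v x * x powr s
                              + (s + 1) * (poly p x * w x * x powr s))"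
    by (simp add: distrib_right mult.assoc)
  also have "\<dots> = (LBINT x:{0<..}. x * (poly (pderiv p) x * w x) * x powr s)
      + weighted_integral p v s + (s + 1) * weighted_integral p w s"
    unfolding weighted_integral_def using i by simp
  also have "(LBINT x:{0<..}. x * (poly (pderiv p) x * w x) * x powr s) = weighted_integral (pderiv p) w (s + 1)"
    unfolding weighted_integral_times_id[symmetric] by (simp add: weighted_integral_def mult_ac)
  finally show ?thesis by (simp add: algebra_simps)
qed

lemma is_type2_mop_weighted_integral:
  "is_type2_mop \<nu> \<alpha> n1 n2 n3 p \<longleftrightarrow>
     degree p = n1 + n2 + n3 \<and> lead_coeff p = 1 \<and>
     (\<forall>m<n1. weighted_integral p (\<lambda>x. rho \<nu> x * rho \<nu> x) (\<alpha> + real m) = 0) \<and>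
     (\<forall>m<n2. weighted_integral p (\<lambda>x. rho (\<nu> + 1) x * rho (\<nu> + 1) x) (\<alpha> + real m) = 0) \<and>
     (\<forall>m<n3. weighted_integral p (\<lambda>x. rho \<nu> x * rho (\<nu> + 1) x) (\<alpha> + real m) = 0)"
  by (simp add: is_type2_mop_def weighted_integral_def power2_eq_square)

lemma moderate_rho_mult: "\<mu> \<ge> 0 \<Longrightarrow> \<nu> \<ge> 0 \<Longrightarrow> moderate (\<lambda>x. rho \<mu> x * rho \<nu> x)"
  by (intro moderate_mult moderate_rho)

lemma weighted_integral_pderiv_rho_square:
  assumes nu: "\<nu> \<ge> 0" and s: "s > -1"
  shows "weighted_integral (pderiv p) (\<lambda>x. rho \<nu> x * rho \<nu> x) (s + 1) =
    - (s + 1 + 2 * \<nu>) * weighted_integral p (\<lambda>x. rho \<nu> x * rho \<nu> x) s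
    + 2 * weighted_integral p (\<lambda>x. rho \<nu> x * rho (\<nu> + 1) x) s"
proof -
  \<comment> \<open>Here and in the next two lemmas the numerator is arranged as constant multiples,
    sums and multiples by x, so that the linearity and exponent-shift rules for
    \<open>weighted_integral\<close> apply syntactically.\<close>
  have "((\<lambda>x. rho \<nu> x * rho \<nu> x) has_real_derivative
      (2 * \<nu> * (rho \<nu> x * rho \<nu> x) + (- 2) * (rho \<nu> x * rho (\<nu> + 1) x)) / x) (at x)" if "x > 0" for x
    by (rule DERIV_cong[OF DERIV_mult[OF has_real_derivative_rho has_real_derivative_rho]])
       (use that in \<open>simp_all add: field_simps\<close>)
  note weighted_integral_pderiv[OF _ _ s this, of p]
  moreover have "moderate (\<lambda>x. rho \<nu> x * rho \<nu> x)" "moderate (\<lambda>x. rho (\<nu> + 1) x * rho (\<nu> + 1) x)" "moderate (\<lambda>x. rho \<nu> x * rho (\<nu> + 1) x)"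
    using nu by (auto intro: moderate_rho_mult)
  ultimately show ?thesis
    using s by (simp only: moderate_add moderate_times_id moderate_cmult weighted_integral_add
        weighted_integral_times_id weighted_integral_cmult) (simp add: algebra_simps)
qed

lemma weighted_integral_pderiv_rho_Suc_square:
  assumes nu: "\<nu> \<ge> 0" and s: "s > -1"
  shows "weighted_integral (pderiv p) (\<lambda>x. rho (\<nu> + 1) x * rho (\<nu> + 1) x) (s + 1) =
    - (s + 1) * weighted_integral p (\<lambda>x. rho (\<nu> + 1) x * rho (\<nu> + 1) x) s
    + 2 * weighted_integral p (\<lambda>x. rho \<nu> x * rho (\<nu> + 1) x) (s + 1)"
proof -
  \<comment> \<open>The lowering relation has no denominator, so a factor x is inserted to match the
    form v x / x; it reappears as the exponent s + 1 on the right.\<close>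
  have "((\<lambda>x. rho (\<nu> + 1) x * rho (\<nu> + 1) x) has_real_derivative
      ((- 2) * (x * (rho \<nu> x * rho (\<nu> + 1) x))) / x) (at x)" if "x > 0" for x
    by (rule DERIV_cong[OF DERIV_mult[OF has_real_derivative_rho_Suc has_real_derivative_rho_Suc]])
       (use that in \<open>simp_all add: field_simps\<close>)
  note weighted_integral_pderiv[OF _ _ s this, of p]
  moreover have "moderate (\<lambda>x. rho \<nu> x * rho \<nu> x)" "moderate (\<lambda>x. rho (\<nu> + 1) x * rho (\<nu> + 1) x)" "moderate (\<lambda>x. rho \<nu> x * rho (\<nu> + 1) x)"
    using nu by (auto intro: moderate_rho_mult)
  ultimately show ?thesis
    using s by (simp only: moderate_add moderate_times_id moderate_cmult weighted_integral_add
        weighted_integral_times_id weighted_integral_cmult)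
qed

lemma weighted_integral_pderiv_rho_rho_Suc:
  assumes nu: "\<nu> \<ge> 0" and s: "s > -1"
  shows "weighted_integral (pderiv p) (\<lambda>x. rho \<nu> x * rho (\<nu> + 1) x) (s + 1) =
    - (s + 1 + \<nu>) * weighted_integral p (\<lambda>x. rho \<nu> x * rho (\<nu> + 1) x) s
    + weighted_integral p (\<lambda>x. rho (\<nu> + 1) x * rho (\<nu> + 1) x) s
    + weighted_integral p (\<lambda>x. rho \<nu> x * rho \<nu> x) (s + 1)"
proof -
  have "((\<lambda>x. rho \<nu> x * rho (\<nu> + 1) x) has_real_derivative
      (\<nu> * (rho \<nu> x * rho (\<nu> + 1) x) + ((- 1) * (rho (\<nu> + 1) x * rho (\<nu> + 1) x) + (- 1) * (x * (rho \<nu> x * rho \<nu> x)))) / x) (at x)" if "x > 0" for x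
    by (rule DERIV_cong[OF DERIV_mult[OF has_real_derivative_rho has_real_derivative_rho_Suc]])
       (use that in \<open>simp_all add: field_simps\<close>)
  note weighted_integral_pderiv[OF _ _ s this, of p]
  moreover have "moderate (\<lambda>x. rho \<nu> x * rho \<nu> x)" "moderate (\<lambda>x. rho (\<nu> + 1) x * rho (\<nu> + 1) x)" "moderate (\<lambda>x. rho \<nu> x * rho (\<nu> + 1) x)"
    using nu by (auto intro: moderate_rho_mult)
  ultimately show ?thesis
    using s by (simp only: moderate_add moderate_times_id moderate_cmult weighted_integral_add
        weighted_integral_times_id weighted_integral_cmult) (simp add: algebra_simps)
qed

section \<open>The derivative of the orthogonal polynomial\<close>

text \<open>The indices close up: with u and v for the two functions, condition m on p' for u * u
  uses u * u and u * v at m; for v * v it uses v * v at m and u * v at m and m + 1 at most; for u *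
  v it uses u * v and v * v at m and u * u at m + 1. As m + 1 \<le> n in the last two cases, the n +
  1 conditions on u * u and u * v suffice. The scalar makes the derivative monic.\<close>

lemma is_type2_mop_pderiv:
  assumes "\<nu> \<ge> 0" "\<alpha> > -1" and p: "is_type2_mop \<nu> \<alpha> (n + 1) n (n + 1) p"
  shows "is_type2_mop \<nu> (\<alpha> + 1) (n + 1) n n (smult (1 / (3 * real n + 2)) (pderiv p))"
proof -
  let ?u = "rho \<nu>" and ?v = "rho (\<nu> + 1)"
  have deg: "degree p = 3 * n + 2" and lead: "lead_coeff p = 1"
    and uu: "\<And>m. m < n + 1 \<Longrightarrow> weighted_integral p (\<lambda>x. ?u x * ?u x) (\<alpha> + real m) = 0"
    and vv: "\<And>m. m < n \<Longrightarrow> weighted_integral p (\<lambda>x. ?v x * ?v x) (\<alpha> + real m) = 0"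
    and uv: "\<And>m. m < n + 1 \<Longrightarrow> weighted_integral p (\<lambda>x. ?u x * ?v x) (\<alpha> + real m) = 0"
    using p by (auto simp: is_type2_mop_weighted_integral)
  \<comment> \<open>The first equation exposes the exponent s + 1 required by integration by parts,
    with s = \<alpha> + m; the second reads the exponents that remain raised as the condition with
    index \<open>Suc m\<close>.\<close>
  have shift: "\<alpha> + 1 + real m = (\<alpha> + real m) + 1" "\<alpha> + real m + 1 = \<alpha> + real (Suc m)" for m
    by simp_all
  have s: "\<alpha> + real m > -1" for m
    using assms(2) by simp
  have deg': "degree (pderiv p) = 3 * n + 1"
    using deg by (simp add: degree_pderiv)
  have "coeff (pderiv p) (3 * n + 1) = 3 * real n + 2"
    using lead by (simp add: coeff_pderiv deg)
  moreover have "3 * real n + 2 \<noteq> 0" by linarith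
  moreover have "weighted_integral (pderiv p) (\<lambda>x. ?u x * ?u x) (\<alpha> + 1 + real m) = 0" if "m < n + 1" for m
    unfolding shift(1) weighted_integral_pderiv_rho_square[OF assms(1) s] using uu uv that by simp
  moreover have "weighted_integral (pderiv p) (\<lambda>x. ?v x * ?v x) (\<alpha> + 1 + real m) = 0"
    and "weighted_integral (pderiv p) (\<lambda>x. ?u x * ?v x) (\<alpha> + 1 + real m) = 0" if "m < n" for m
    unfolding shift(1) weighted_integral_pderiv_rho_Suc_square[OF assms(1) s]
      weighted_integral_pderiv_rho_rho_Suc[OF assms(1) s]
    unfolding shift(2) using uu[of "Suc m"] vv[of m] uv[of m] uv[of "Suc m"] that by simp_all
  ultimately show ?thesis
    using deg' by (simp add: is_type2_mop_weighted_integral weighted_integral_smult)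
qed

theorem theorem6:
  fixes \<nu> \<alpha> x :: real and n :: nat
  assumes "\<nu> \<ge> 0" and "\<alpha> > -1"
    and "\<exists>!p. is_type2_mop \<nu> \<alpha> (n + 1) n (n + 1) p"
    and "\<exists>!q. is_type2_mop \<nu> (\<alpha> + 1) (n + 1) n n q"
  shows "(poly (type2_mop \<nu> \<alpha> (n + 1) n (n + 1)) has_real_derivative
           (3 * real n + 2) * poly (type2_mop \<nu> (\<alpha> + 1) (n + 1) n n) x) (at x)"
proof -
  let ?p = "type2_mop \<nu> \<alpha> (n + 1) n (n + 1)"
  \<comment> \<open>\<open>type2_mop\<close> is a definite description: unique existence on the left
    gives its defining properties, and on the right it identifies the normalized derivative with
    it.\<close>
  have "is_type2_mop \<nu> \<alpha> (n + 1) n (n + 1) ?p"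
    unfolding type2_mop_def by (rule theI'[OF assms(3)])
  from is_type2_mop_pderiv[OF assms(1,2) this]
  have "type2_mop \<nu> (\<alpha> + 1) (n + 1) n n = smult (1 / (3 * real n + 2)) (pderiv ?p)"
    unfolding type2_mop_def by (rule the1_equality[OF assms(4)])
  moreover have "3 * real n + 2 \<noteq> 0" by linarith
  ultimately show ?thesis
    using poly_DERIV[of ?p x] by simp
qed

end
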